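(* Let $\Lambda\subset\mathbb{N}_0^d$ be an arbitrary finite index set. The tent-transformed lattice rule $Q_n$ of a rank-1 lattice rule $Q_n^*$ with $n$ points and generating vector $\boldsymbol{z}\in\mathbb{Z}^d$ integrates exactly all cosine space functions $f\in\mathcal{F}^{\cos}_\Lambda$ solely supported on $\Lambda$ if and only if $$\boldsymbol{h}\cdot\boldsymbol{z}\not\equiv0\pmod n\qquad\text{for all }\boldsymbol{h}\in\mathcal{M}(\Lambda)\setminus\{\boldsymbol{0}\}.$$ Such a generating vector $\boldsymbol{z}$ can be constructed component-by-component if $n$ is a prime satisfying $$n>\max\Big\{\frac{\#(\mathcal{M}(\Lambda)\setminus\{\boldsymbol{0}\})}{2}+1,\ \max(\Lambda)\Big\}.$$
   Context: Cosine basis: $\phi_{\boldsymbol{k}}(\boldsymbol{x})=\sqrt2^{\,|\boldsymbol{k}|_0}\prod_{j=1}^d\cos(\pi k_jx_j)$ on $[0,1]^d$, $\boldsymbol{k}\in\mathbb{N}_0^d$, with $|\boldsymbol{k}|_0$ the number of nonzero components. $\mathcal{F}^{\cos}_\Lambda$ is the set of real-valued functions $f=\sum_{\boldsymbol{k}\in\Lambda}\widehat f_{\boldsymbol{k}}\,\phi_{\boldsymbol{k}}$ on $[0,1]^d$. The rank-1 lattice rule is $Q_n^*(g)=\frac1n\sum_{i=0}^{n-1}g\big(\frac{i\boldsymbol{z}\bmod n}{n}\big)$ (mod applied componentwise), and the tent-transformed rule is $Q_n(f)=Q_n^*(f\circ\varphi_{\rm tent})$, where $\varphi_{\rm tent}(x)=1-|2x-1|$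 is applied componentwise. $Q_n$ integrates $f$ exactly if $Q_n(f)=\int_{[0,1]^d}f(\boldsymbol{x})\,d\boldsymbol{x}$. $\mathcal{M}(\Lambda)=\{(\sigma_1k_1,\ldots,\sigma_dk_d):\boldsymbol{k}\in\Lambda,\boldsymbol{\sigma}\in\{\pm1\}^d\}$; $\max(\Lambda)=\max_{\boldsymbol{k}\in\Lambda}\max_j|k_j|$; $\#$ is cardinality. "Constructed component-by-component": for an index set $\mathcal{A}\subset\mathbb{Z}^d$ (here $\mathcal{A}=\mathcal{M}(\Lambda)$) and its projections $\mathcal{A}_s$, $s=1,\ldots,d$, given either by $\mathcal{A}_s=\{\boldsymbol{h}\in\mathbb{Z}^s:(\boldsymbol{h},\boldsymbol{0})\in\mathcal{A}\}$ or by $\mathcal{A}_s=\{\boldsymbol{h}\in\mathbb{Z}^s:(\boldsymbol{h},\boldsymbol{h}_\perp)\in\mathcal{A}\text{ for some }\boldsymbol{h}_\perp\}$, the components $z_1,\ldots,z_d\in\{1,\ldots,n-1\}$ can be chosen one at a time: whenever $z_1,\ldots,z_{s-1}$ satisfy $\boldsymbol{h}\cdot(z_1,\ldots,z_{s-1})\not\equiv0\pmod n$ for all $\boldsymbol{h}\in\mathcal{A}_{s-1}\setminus\{\boldsymbol{0}\}$ (no condition if $s=1$), there exists $z_s\in\{1,\ldots,n-1\}$ with $\boldsymbol{h}\cdot(z_1,\ldots,z_s)\not\equiv0\pmod n$ for all $\boldsymbol{h}\in\mathcal{A}_s\setminus\{\boldsymbol{0}\}$. Since $\mathcal{A}_d=\mathcal{A}$,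 the resulting $\boldsymbol{z}$ satisfies the required condition. *)

theory Defs
  imports "HOL-Analysis.Analysis" "HOL-Number_Theory.Cong"
    "HOL-Computational_Algebra.Primes"
begin

text \<open>
  An \<open>s\<close>-dimensional vector over a set \<open>S\<close> is an element of \<open>{1..s} \<rightarrow>\<^sub>E S\<close>, i.e. a function on the
  index set \<open>{1..s}\<close> that is \<open>undefined\<close> outside of it. Thus \<open>\<lambda>j\<in>{1..s}. 0\<close> is the zero vector, and
  \<open>merge {1..s} {s+1..d} (h, h')\<close> is the concatenation \<open>(h, h')\<close> of an \<open>s\<close>-dimensional and a
  \<open>(d - s)\<close>-dimensional vector (the latter indexed by \<open>{s+1..d}\<close>).
\<close>

definition unit_cube :: "nat \<Rightarrow> (nat \<Rightarrow> real) set" where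
  "unit_cube d = {1..d} \<rightarrow>\<^sub>E {0..1}"

definition cube_integral :: "nat \<Rightarrow> ((nat \<Rightarrow> real) \<Rightarrow> real) \<Rightarrow> real" where
  "cube_integral d f = (LINT x : unit_cube d | Pi\<^sub>M {1..d} (\<lambda>_. lborel). f x)"

definition cos_basis :: "nat \<Rightarrow> (nat \<Rightarrow> nat) \<Rightarrow> (nat \<Rightarrow> real) \<Rightarrow> real" where
  "cos_basis d k x =
     sqrt 2 ^ card {j \<in> {1..d}. k j \<noteq> 0} * (\<Prod>j = 1..d. cos (pi * real (k j) * x j))"

text \<open>
  The functions on the cube are represented by total functions; their values outside the cube
  are irrelevant to everything below. The index set is meant to be finite.
\<close>

definition cosine_space :: "nat \<Rightarrow> (nat \<Rightarrow> nat) set \<Rightarrow> ((nat \<Rightarrow> real) \<Rightarrow> real) set" where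
  "cosine_space d \<Lambda> =
     {f. \<exists>c :: (nat \<Rightarrow> nat) \<Rightarrow> real. \<forall>x \<in> unit_cube d. f x = (\<Sum>k\<in>\<Lambda>. c k * cos_basis d k x)}"

definition lattice_rule ::
    "nat \<Rightarrow> nat \<Rightarrow> (nat \<Rightarrow> int) \<Rightarrow> ((nat \<Rightarrow> real) \<Rightarrow> real) \<Rightarrow> real" where
  "lattice_rule d n z g =
     (1 / real n) *
     (\<Sum>i<n. g (\<lambda>j\<in>{1..d}. real_of_int ((int i * z j) mod int n) / real n))"

definition tent :: "real \<Rightarrow> real" where
  "tent x = 1 - \<bar>2 * x - 1\<bar>"

definition tent_vec :: "nat \<Rightarrow> (nat \<Rightarrow> real) \<Rightarrow> (nat \<Rightarrow> real)" where
  "tent_vec d x = (\<lambda>j\<in>{1..d}. tent (x j))"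

definition tent_lattice_rule ::
    "nat \<Rightarrow> nat \<Rightarrow> (nat \<Rightarrow> int) \<Rightarrow> ((nat \<Rightarrow> real) \<Rightarrow> real) \<Rightarrow> real" where
  "tent_lattice_rule d n z f = lattice_rule d n z (f \<circ> tent_vec d)"

definition mirrored :: "nat \<Rightarrow> (nat \<Rightarrow> nat) set \<Rightarrow> (nat \<Rightarrow> int) set" where
  "mirrored d \<Lambda> =
     {(\<lambda>j\<in>{1..d}. \<sigma> j * int (k j)) | k \<sigma>. k \<in> \<Lambda> \<and> \<sigma> \<in> {1..d} \<rightarrow>\<^sub>E {-1, 1}}"

text \<open>The maximum over an empty index set is taken to be \<open>0\<close>.\<close>

definition max_index :: "nat \<Rightarrow> (nat \<Rightarrow> nat) set \<Rightarrow> nat" where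
  "max_index d \<Lambda> = Max (insert 0 {k j | k j. k \<in> \<Lambda> \<and> j \<in> {1..d}})"

definition zero_vec :: "nat \<Rightarrow> (nat \<Rightarrow> int)" where
  "zero_vec s = (\<lambda>j\<in>{1..s}. 0)"

definition nonzero_mod :: "nat \<Rightarrow> nat \<Rightarrow> (nat \<Rightarrow> int) set \<Rightarrow> (nat \<Rightarrow> int) \<Rightarrow> bool" where
  "nonzero_mod s n A z \<longleftrightarrow>
     (\<forall>h \<in> A - {zero_vec s}. \<not> [(\<Sum>j = 1..s. h j * z j) = 0] (mod int n))"

definition zero_section :: "nat \<Rightarrow> (nat \<Rightarrow> int) set \<Rightarrow> nat \<Rightarrow> (nat \<Rightarrow> int) set" where
  "zero_section d A s =
     {h \<in> {1..s} \<rightarrow>\<^sub>E UNIV. merge {1..s} {s+1..d} (h, \<lambda>j\<in>{s+1..d}. 0) \<in> A}"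

definition full_projection :: "nat \<Rightarrow> (nat \<Rightarrow> int) set \<Rightarrow> nat \<Rightarrow> (nat \<Rightarrow> int) set" where
  "full_projection d A s =
     {h \<in> {1..s} \<rightarrow>\<^sub>E UNIV. \<exists>h' \<in> {s+1..d} \<rightarrow>\<^sub>E UNIV. merge {1..s} {s+1..d} (h, h') \<in> A}"

text \<open>
  The argument \<open>P\<close> is the family of projections \<open>A\<^sub>s\<close> of \<open>A\<close>. The first conjunct says that every
  admissible choice of the first \<open>s - 1\<close> components can be extended by one component; for \<open>s = 1\<close>
  its premise is void, since the only \<open>0\<close>-dimensional vector is the zero vector. The other two
  say that any vector resulting from this process satisfies the condition for \<open>A\<close> itself and
  that there is such a vector.
\<close>

definition cbc_constructible ::
    "nat \<Rightarrow> nat \<Rightarrow> (nat \<Rightarrow> int) set \<Rightarrow> (nat \<Rightarrow> (nat \<Rightarrow> int) set) \<Rightarrow> bool" where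
  "cbc_constructible d n A P \<longleftrightarrow>
     (\<forall>s \<in> {1..d}. \<forall>z \<in> {1..s-1} \<rightarrow>\<^sub>E {1..int n - 1}.
        nonzero_mod (s - 1) n (P (s - 1)) z \<longrightarrow>
        (\<exists>z\<^sub>s \<in> {1..int n - 1}. nonzero_mod s n (P s) (z(s := z\<^sub>s)))) \<and>
     (\<forall>z \<in> {1..d} \<rightarrow>\<^sub>E {1..int n - 1}.
        (\<forall>s \<in> {1..d}. nonzero_mod s n (P s) (restrict z {1..s})) \<longrightarrow> nonzero_mod d n A z) \<and>
     (\<exists>z \<in> {1..d} \<rightarrow>\<^sub>E {1..int n - 1}.
        \<forall>s \<in> {1..d}. nonzero_mod s n (P s) (restrict z {1..s}))"

end

theory Submission imports Defs begin

text \<open>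
  On lattice points the tent transformation doubles frequencies:
  \<open>cos (\<pi> k (tent x)) = cos (2 \<pi> k x)\<close> for integers \<open>k\<close>. Writing each cosine as the mean of
  the characters of frequency \<open>k\<close> and \<open>- k\<close> and expanding the product, the basis function of
  index \<open>k\<close> becomes a positive multiple of the sum, over all sign patterns \<open>\<sigma>\<close>, of the
  characters with frequency \<open>h = (\<sigma>\<^sub>1 k\<^sub>1, \<dots>, \<sigma>\<^sub>d k\<^sub>d)\<close>. A lattice rule maps such a character
  to \<open>1\<close> if \<open>h \<cdot> z \<equiv> 0 (mod n)\<close> and to \<open>0\<close> otherwise. All contributions being nonnegative,
  nothing cancels, and the rule sends a nonconstant basis function to its integral \<open>0\<close> exactly
  when no mirror image of \<open>k\<close> is orthogonal to \<open>z\<close> modulo \<open>n\<close>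
  (\<open>tent_lattice_rule_cos_basis\<close>, \<open>cube_integral_cos_basis\<close>). By linearity, exactness on the
  space is exactness on the basis (\<open>exact_on_cosine_space_iff_exact_on_basis\<close>).

  For the construction, suppose that \<open>z\<^sub>1, \<dots>, z\<^sub>s\<^sub>-\<^sub>1\<close> are admissible. An index \<open>h\<close> with
  \<open>h\<^sub>s = 0\<close> satisfies the condition already for the shorter vector. An index with \<open>h\<^sub>s \<noteq> 0\<close> has \<open>h\<^sub>s\<close>
  invertible modulo the prime \<open>n > \<bar>h\<^sub>s\<bar>\<close> and so rules out at most one value of \<open>z\<^sub>s\<close>, and
  \<open>-h\<close> rules out the same value. Hence at most half as many values are ruled out as there are
  nonzero indices, which leaves one of the \<open>n - 1\<close> candidates (\<open>cbc_step\<close>). Of the two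
  families of projections only closure under negation and compatibility with dropping a last
  zero component enter (\<open>cbc_constructible_of_symmetric_projections\<close>); the cardinality is
  controlled since both are contained in the image of the index set under restriction.
\<close>

section \<open>Characters on a rank-1 lattice\<close>

lemma sum_lattice_character:
  fixes m :: int
  assumes "n \<ge> 1"
  shows "(\<Sum>i<n. cis (2 * pi * (real i * real_of_int m / real n))) =
         (if [m = 0] (mod int n) then of_nat n else 0)"
proof -
  define w where "w = cis (2 * pi * (real_of_int m / real n))"
  have n: "real n \<noteq> 0"
    using assms by simp
  have powers: "cis (2 * pi * (real i * real_of_int m / real n)) = w ^ i" for i
  proof -
    have "2 * pi * (real i * real_of_int m / real n) = real i * (2 * pi * (real_of_int m / real n))"
      by simp
    then show ?thesis
      by (simp only: w_def Complex.DeMoivre)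
  qed
  have "w ^ n = cis (2 * pi * of_int m)"
    using n by (simp add: w_def Complex.DeMoivre)
  then have wn: "w ^ n = 1"
    by (simp add: cis_multiple_2pi)
  have w1: "w = 1 \<longleftrightarrow> [m = 0] (mod int n)"
  proof
    assume "w = 1"
    then have "cos (2 * pi * (real_of_int m / real n)) = 1"
      by (metis w_def cis.sel(1) one_complex.sel(1))
    then obtain q :: int where "2 * pi * (real_of_int m / real n) = of_int q * 2 * pi"
      by (auto simp: cos_one_2pi_int)
    then have "real_of_int m = of_int q * real n"
      using n by (simp add: field_simps)
    then have "m = q * int n"
      by (metis of_int_eq_iff of_int_mult of_int_of_nat_eq)
    then show "[m = 0] (mod int n)"
      by (simp add: cong_0_iff)
  next
    assume "[m = 0] (mod int n)"
    then obtain q where "m = int n * q"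
      by (auto simp: cong_0_iff)
    then have "w = cis (2 * pi * of_int q)"
      using n by (simp add: w_def)
    then show "w = 1"
      by (simp add: cis_multiple_2pi)
  qed
  show ?thesis
  proof (cases "w = 1")
    case True
    then show ?thesis using w1 unfolding powers by simp
  next
    case False
    then show ?thesis using w1 wn unfolding powers by (simp add: geometric_sum)
  qed
qed

lemma cis_sum: "finite J \<Longrightarrow> cis (\<Sum>j\<in>J. a j) = (\<Prod>j\<in>J. cis (a j))"
  by (induction J rule: finite_induct) (simp_all add: cis_mult[symmetric])

text \<open>
  The product-to-sum formula, obtained by expanding \<open>\<Prod>\<^sub>j (e\<^bsup>i a\<^sub>j\<^esup> + e\<^bsup>- i a\<^sub>j\<^esup>) / 2\<close>. The right-hand
  side is kept complex, since it is about to be summed as a geometric series.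
\<close>

lemma prod_cos_eq_sum_signs:
  fixes a :: "nat \<Rightarrow> real"
  assumes "finite J"
  shows "complex_of_real (\<Prod>j\<in>J. cos (a j)) =
         (\<Sum>\<sigma> \<in> J \<rightarrow>\<^sub>E {-1, 1::int}. cis (\<Sum>j\<in>J. of_int (\<sigma> j) * a j)) / 2 ^ card J"
proof -
  have euler: "complex_of_real (cos t) = (\<Sum>e\<in>{-1, 1::int}. cis (of_int e * t)) / 2" for t
    by (simp add: complex_eq_iff)
  have "complex_of_real (\<Prod>j\<in>J. cos (a j)) =
             (\<Prod>j\<in>J. (\<Sum>e\<in>{-1, 1::int}. cis (of_int e * a j)) / 2)"
    by (simp only: of_real_prod euler)
  also have "\<dots> = (\<Prod>j\<in>J. \<Sum>e\<in>{-1, 1::int}. cis (of_int e * a j)) / 2 ^ card J"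
    by (simp add: prod_dividef)
  also have "(\<Prod>j\<in>J. \<Sum>e\<in>{-1, 1::int}. cis (of_int e * a j)) =
             (\<Sum>\<sigma> \<in> J \<rightarrow>\<^sub>E {-1, 1::int}. \<Prod>j\<in>J. cis (of_int (\<sigma> j) * a j))"
    by (rule prod_sum_PiE) (use assms in auto)
  finally show ?thesis
    using assms by (simp add: cis_sum)
qed

section \<open>The tent-transformed rule on the cosine basis\<close>

lemma tent_in_unit_interval: "x \<in> {0..1} \<Longrightarrow> tent x \<in> {0..1}"
  by (auto simp: tent_def abs_if)

lemma cos_tent: "cos (pi * real k * tent x) = cos (2 * pi * real k * x)"
proof (cases "2 * x - 1 < 0")
  case True
  then show ?thesis by (simp add: tent_def algebra_simps)
next
  case False
  then have "pi * real k * tent x = 2 * pi * of_int (int k) - 2 * pi * real k * x"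
    by (simp add: tent_def algebra_simps)
  then show ?thesis
    by (simp add: cos_diff cos_int_2pin sin_int_2pin del: of_int_of_nat_eq)
qed

text \<open>Reduction modulo \<open>n\<close> is invisible to functions of period \<open>1\<close>.\<close>

lemma cos_lattice_point:
  fixes m :: int
  assumes "n \<ge> 1"
  shows "cos (2 * pi * real k * (real_of_int (m mod int n) / real n)) =
         cos (2 * pi * (real k * real_of_int m / real n))"
proof -
  have "real_of_int m = real n * real_of_int (m div int n) + real_of_int (m mod int n)"
    by (metis mult_div_mod_eq of_int_add of_int_mult of_int_of_nat_eq)
  then have "2 * pi * (real k * real_of_int m / real n) =
      2 * pi * of_int (int k * (m div int n)) + 2 * pi * real k * (real_of_int (m mod int n) / real n)"
    using assms by (simp add: field_simps)
  then show ?thesis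
    using cos_int_2pin[of "int k * (m div int n)"] sin_int_2pin[of "int k * (m div int n)"]
    by (simp add: cos_add)
qed

text \<open>
  Each sign pattern whose mirrored index is orthogonal to \<open>z\<close> contributes the same positive
  amount; counting them makes the absence of cancellation visible.
\<close>

lemma tent_lattice_rule_cos_basis:
  assumes "n \<ge> 1"
  shows "tent_lattice_rule d n z (cos_basis d k) =
         sqrt 2 ^ card {j \<in> {1..d}. k j \<noteq> 0} / 2 ^ d *
         real (card {\<sigma> \<in> {1..d} \<rightarrow>\<^sub>E {-1, 1}. [(\<Sum>j = 1..d. \<sigma> j * int (k j) * z j) = 0] (mod int n)})"
    (is "_ = ?w / 2 ^ d * real (card {\<sigma> \<in> ?S. ?orth \<sigma>})")
proof -
  let ?dot = "\<lambda>\<sigma>. \<Sum>j = 1..d. \<sigma> j * int (k j) * z j"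
  have fin: "finite ?S"
    by (intro finite_PiE) auto
  have factor: "cos (pi * real (k j) * tent (real_of_int ((int i * z j) mod int n) / real n)) =
      cos (2 * pi * (real (k j) * real_of_int (int i * z j) / real n))" for i j
    by (simp only: cos_tent cos_lattice_point[OF assms])
  have value_at_point: "(cos_basis d k \<circ> tent_vec d)
          (\<lambda>j\<in>{1..d}. real_of_int ((int i * z j) mod int n) / real n) =
        ?w * (\<Prod>j = 1..d. cos (2 * pi * (real (k j) * real_of_int (int i * z j) / real n)))" for i
    unfolding cos_basis_def tent_vec_def o_def
    by (intro arg_cong2[where f="(*)"] prod.cong refl) (simp only: restrict_apply' factor)
  have "complex_of_real (\<Sum>i<n. \<Prod>j = 1..d. cos (2 * pi * (real (k j) * real_of_int (int i * z j) / real n)))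
      = (\<Sum>i<n. (\<Sum>\<sigma>\<in>?S. cis (\<Sum>j = 1..d. of_int (\<sigma> j) *
             (2 * pi * (real (k j) * real_of_int (int i * z j) / real n)))) / 2 ^ d)"
    unfolding of_real_sum by (intro sum.cong refl, subst prod_cos_eq_sum_signs) auto
  also have "\<dots> = (\<Sum>i<n. \<Sum>\<sigma>\<in>?S. cis (2 * pi * (real i * real_of_int (?dot \<sigma>) / real n))) / 2 ^ d"
    unfolding sum_divide_distrib[symmetric]
    by (intro arg_cong2[where f="(/)"] sum.cong arg_cong[where f=cis] refl)
       (simp add: sum_distrib_left sum_divide_distrib mult_ac)
  also have "\<dots> = (\<Sum>\<sigma>\<in>?S. \<Sum>i<n. cis (2 * pi * (real i * real_of_int (?dot \<sigma>) / real n))) / 2 ^ d"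
    by (subst sum.swap) rule
  also have "\<dots> = (\<Sum>\<sigma>\<in>?S. if ?orth \<sigma> then of_nat n else 0) / 2 ^ d"
    by (subst sum_lattice_character[OF assms]) rule
  also have "\<dots> = complex_of_real (real n * real (card {\<sigma>\<in>?S. ?orth \<sigma>}) / 2 ^ d)"
    using fin by (simp add: sum.If_cases Int_def mult.commute)
  finally have "(\<Sum>i<n. \<Prod>j = 1..d. cos (2 * pi * (real (k j) * real_of_int (int i * z j) / real n)))
      = real n * real (card {\<sigma>\<in>?S. ?orth \<sigma>}) / 2 ^ d"
    unfolding of_real_eq_iff .
  then show ?thesis
    using assms
    unfolding tent_lattice_rule_def lattice_rule_def value_at_point sum_distrib_left[symmetric]
    by simp
qed

section \<open>Integrals over the cube\<close>

lemma integral_cos_unit_interval: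
  "(\<integral>t. indicator {0..1} t * cos (pi * real k * t) \<partial>lborel) = (if k = 0 then 1 else 0)"
proof (cases "k = 0")
  case True
  then show ?thesis by simp
next
  case False
  have "(\<integral>t. indicator {0..1} t *\<^sub>R cos (pi * real k * t) \<partial>lborel) =
        sin (pi * real k * 1) / (pi * real k) - sin (pi * real k * 0) / (pi * real k)"
    by (rule integral_FTC_atLeastAtMost)
       (use False in \<open>auto intro!: derivative_eq_intros continuous_intros
         simp flip: has_real_derivative_iff_has_vector_derivative\<close>)
  also have "\<dots> = 0"
    using sin_npi2[of k] by simp
  finally show ?thesis using False by simp
qed

lemma indicator_unit_cube:
  assumes "x \<in> extensional {1..d}"
  shows "(indicator (unit_cube d) x :: real) = (\<Prod>j = 1..d. indicator {0..1} (x j))"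
proof (cases "x \<in> unit_cube d")
  case True
  then show ?thesis by (auto simp: unit_cube_def PiE_iff)
next
  case False
  then obtain j where "j \<in> {1..d}" "x j \<notin> {0..1}"
    using assms by (auto simp: unit_cube_def PiE_iff)
  then have "(\<Prod>j = 1..d. indicator {0..1} (x j) :: real) = 0"
    by (intro prod_zero) (auto intro!: bexI[of _ j])
  then show ?thesis using False by simp
qed

lemma
  shows set_integrable_cos_basis:
      "set_integrable (Pi\<^sub>M {1..d} (\<lambda>_. lborel)) (unit_cube d) (cos_basis d k)"
    and cube_integral_cos_basis:
      "cube_integral d (cos_basis d k) = (if \<forall>j\<in>{1..d}. k j = 0 then 1 else 0)"
proof -
  interpret product_sigma_finite "\<lambda>_::nat. lborel :: real measure"
    by standard
  let ?M = "Pi\<^sub>M {1..d} (\<lambda>_. lborel :: real measure)"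
  let ?w = "sqrt 2 ^ card {j \<in> {1..d}. k j \<noteq> 0}"
  let ?g = "\<lambda>j t. indicator {0..1} t * cos (pi * real (k j) * t)"
  have product: "indicator (unit_cube d) x *\<^sub>R cos_basis d k x = ?w * (\<Prod>j = 1..d. ?g j (x j))"
    if "x \<in> space ?M" for x
    using that by (simp add: indicator_unit_cube space_PiM PiE_def cos_basis_def prod.distrib)
  have int1: "integrable lborel (?g j)" for j
    using borel_integrable_atLeastAtMost'[of 0 1 "\<lambda>t. cos (pi * real (k j) * t)"]
    by (simp add: set_integrable_def continuous_intros)
  have "integrable ?M (\<lambda>x. ?w * (\<Prod>j = 1..d. ?g j (x j)))"
    by (intro integrable_mult_right product_integrable_prod) (use int1 in auto)
  then show "set_integrable ?M (unit_cube d) (cos_basis d k)"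
    unfolding set_integrable_def by (subst Bochner_Integration.integrable_cong[OF refl product]) auto
  have "cube_integral d (cos_basis d k) = (\<integral>x. ?w * (\<Prod>j = 1..d. ?g j (x j)) \<partial>?M)"
    unfolding cube_integral_def set_lebesgue_integral_def
    by (rule Bochner_Integration.integral_cong[OF refl product])
  also have "\<dots> = ?w * (\<Prod>j = 1..d. \<integral>t. ?g j t \<partial>lborel)"
    by (simp add: product_integral_prod[OF _ int1])
  also have "\<dots> = ?w * (\<Prod>j = 1..d. if k j = 0 then 1 else 0)"
    by (simp only: integral_cos_unit_interval)
  also have "\<dots> = (if \<forall>j\<in>{1..d}. k j = 0 then 1 else 0)"
  proof (cases "\<forall>j\<in>{1..d}. k j = 0")
    case True
    then have no_support: "{j \<in> {1..d}. k j \<noteq> 0} = {}"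
      by auto
    show ?thesis
      unfolding no_support using True by simp
  qed auto
  finally show "cube_integral d (cos_basis d k) = (if \<forall>j\<in>{1..d}. k j = 0 then 1 else 0)" .
qed

section \<open>Exactness on the cosine space\<close>

lemma cube_integral_cosine_sum:
  assumes "finite \<Lambda>" and "\<And>x. x \<in> unit_cube d \<Longrightarrow> f x = (\<Sum>k\<in>\<Lambda>. c k * cos_basis d k x)"
  shows "cube_integral d f = (\<Sum>k\<in>\<Lambda>. c k * cube_integral d (cos_basis d k))"
proof -
  let ?M = "Pi\<^sub>M {1..d} (\<lambda>_. lborel :: real measure)"
  have "cube_integral d f =
        (\<integral>x. (\<Sum>k\<in>\<Lambda>. c k * (indicator (unit_cube d) x *\<^sub>R cos_basis d k x)) \<partial>?M)"
    unfolding cube_integral_def set_lebesgue_integral_def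
    by (intro Bochner_Integration.integral_cong refl)
       (auto simp: assms(2) indicator_def)
  also have "\<dots> = (\<Sum>k\<in>\<Lambda>. c k * (\<integral>x. indicator (unit_cube d) x *\<^sub>R cos_basis d k x \<partial>?M))"
    using set_integrable_cos_basis[unfolded set_integrable_def]
    by (subst Bochner_Integration.integral_sum) auto
  finally show ?thesis
    by (simp add: cube_integral_def set_lebesgue_integral_def)
qed

lemma tent_lattice_rule_cosine_sum:
  assumes "n \<ge> 1" and "\<And>x. x \<in> unit_cube d \<Longrightarrow> f x = (\<Sum>k\<in>\<Lambda>. c k * cos_basis d k x)"
  shows "tent_lattice_rule d n z f = (\<Sum>k\<in>\<Lambda>. c k * tent_lattice_rule d n z (cos_basis d k))"
proof -
  let ?x = "\<lambda>i. \<lambda>j\<in>{1..d}. real_of_int ((int i * z j) mod int n) / real n"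
  have point: "real_of_int (m mod int n) / real n \<in> {0..1}" for m
  proof -
    have "0 \<le> m mod int n" "m mod int n \<le> int n"
      using assms(1) by (simp_all add: less_imp_le)
    then have "0 \<le> real_of_int (m mod int n)" "real_of_int (m mod int n) \<le> real n"
      by linarith+
    then show ?thesis using assms(1) by simp
  qed
  have "tent_vec d (?x i) \<in> unit_cube d" for i
    using tent_in_unit_interval[OF point] unfolding tent_vec_def unit_cube_def by auto
  then have "(f \<circ> tent_vec d) (?x i) = (\<Sum>k\<in>\<Lambda>. c k * (cos_basis d k \<circ> tent_vec d) (?x i))" for i
    using assms(2) by simp
  then show ?thesis
    unfolding tent_lattice_rule_def lattice_rule_def
    by (simp add: sum_distrib_left mult_ac sum.swap[of _ \<Lambda>])
qed

lemma exact_on_cosine_space_iff_exact_on_basis: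
  assumes "n \<ge> 1" and "finite \<Lambda>"
  shows "(\<forall>f \<in> cosine_space d \<Lambda>. tent_lattice_rule d n z f = cube_integral d f) \<longleftrightarrow>
         (\<forall>k \<in> \<Lambda>. tent_lattice_rule d n z (cos_basis d k) = cube_integral d (cos_basis d k))"
    (is "?L \<longleftrightarrow> ?R")
proof
  assume L: ?L
  have "cos_basis d k \<in> cosine_space d \<Lambda>" if "k \<in> \<Lambda>" for k
    unfolding cosine_space_def using that assms(2)
    by (auto intro!: exI[of _ "\<lambda>k'. if k' = k then 1 else 0"] simp: if_distrib[of "\<lambda>t. t * _"]
        cong: if_cong)
  then show ?R using L by blast
next
  assume R: ?R
  show ?L
  proof
    fix f assume "f \<in> cosine_space d \<Lambda>"
    then obtain c where c: "\<And>x. x \<in> unit_cube d \<Longrightarrow> f x = (\<Sum>k\<in>\<Lambda>. c k * cos_basis d k x)"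
      by (auto simp: cosine_space_def)
    show "tent_lattice_rule d n z f = cube_integral d f"
      using R by (simp add: tent_lattice_rule_cosine_sum[OF assms(1) c]
          cube_integral_cosine_sum[OF assms(2) c])
  qed
qed

lemma mirror_eq_zero_iff:
  assumes "\<sigma> \<in> {1..d} \<rightarrow>\<^sub>E {-1, 1}"
  shows "(\<lambda>j\<in>{1..d}. \<sigma> j * int (k j)) = zero_vec d \<longleftrightarrow> (\<forall>j\<in>{1..d}. k j = 0)"
proof -
  have "\<sigma> j \<noteq> 0" if "j \<in> {1..d}" for j
    using PiE_mem[OF assms that] by auto
  then show ?thesis
    by (auto simp: zero_vec_def restrict_def fun_eq_iff)
qed

text \<open>
  For the constant basis function all \<open>2\<^sup>d\<close> sign patterns count, and the rule is exact. For any
  other index the integral vanishes, so the count of orthogonal mirror images must be \<open>0\<close>.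
\<close>

lemma exact_on_cos_basis_iff:
  assumes "n \<ge> 1"
  shows "tent_lattice_rule d n z (cos_basis d k) = cube_integral d (cos_basis d k) \<longleftrightarrow>
         (\<forall>\<sigma> \<in> {1..d} \<rightarrow>\<^sub>E {-1, 1}. (\<lambda>j\<in>{1..d}. \<sigma> j * int (k j)) \<noteq> zero_vec d \<longrightarrow>
            \<not> [(\<Sum>j = 1..d. \<sigma> j * int (k j) * z j) = 0] (mod int n))"
proof (cases "\<forall>j\<in>{1..d}. k j = 0")
  case True
  then have no_support: "{j \<in> {1..d}. k j \<noteq> 0} = {}" and dot: "(\<Sum>j = 1..d. \<sigma> j * int (k j) * z j) = 0" for \<sigma>
    by auto
  have "real (card ({1..d} \<rightarrow>\<^sub>E {-1, 1::int})) = 2 ^ d"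
    by (simp add: card_PiE)
  then have "tent_lattice_rule d n z (cos_basis d k) = 1"
    unfolding tent_lattice_rule_cos_basis[OF assms] no_support dot by simp
  moreover have "cube_integral d (cos_basis d k) = 1"
    using True by (simp add: cube_integral_cos_basis)
  moreover have "(\<lambda>j\<in>{1..d}. \<sigma> j * int (k j)) = zero_vec d" if "\<sigma> \<in> {1..d} \<rightarrow>\<^sub>E {-1, 1}" for \<sigma>
    using True by (simp only: mirror_eq_zero_iff[OF that])
  ultimately show ?thesis
    by (simp del: One_nat_def)
next
  case False
  let ?O = "{\<sigma> \<in> {1..d} \<rightarrow>\<^sub>E {-1, 1}. [(\<Sum>j = 1..d. \<sigma> j * int (k j) * z j) = 0] (mod int n)}"
  have "finite ?O"
    by (intro finite_subset[OF _ finite_PiE[of "{1..d}" "\<lambda>_. {-1, 1::int}"]]) auto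
  moreover have "cube_integral d (cos_basis d k) = 0"
    using False by (simp add: cube_integral_cos_basis)
  ultimately have "tent_lattice_rule d n z (cos_basis d k) = cube_integral d (cos_basis d k) \<longleftrightarrow> ?O = {}"
    unfolding tent_lattice_rule_cos_basis[OF assms] by simp
  moreover have "(\<lambda>j\<in>{1..d}. \<sigma> j * int (k j)) \<noteq> zero_vec d" if "\<sigma> \<in> {1..d} \<rightarrow>\<^sub>E {-1, 1}" for \<sigma>
    using False by (simp only: mirror_eq_zero_iff[OF that] simp_thms)
  ultimately show ?thesis
    by blast
qed

lemma nonzero_mod_mirrored_iff:
  "nonzero_mod d n (mirrored d \<Lambda>) z \<longleftrightarrow>
     (\<forall>k \<in> \<Lambda>. \<forall>\<sigma> \<in> {1..d} \<rightarrow>\<^sub>E {-1, 1}. (\<lambda>j\<in>{1..d}. \<sigma> j * int (k j)) \<noteq> zero_vec d \<longrightarrow>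
        \<not> [(\<Sum>j = 1..d. \<sigma> j * int (k j) * z j) = 0] (mod int n))"
proof -
  let ?m = "\<lambda>k \<sigma>. \<lambda>j\<in>{1..d}. \<sigma> j * int (k j)"
  have dot: "(\<Sum>j = 1..d. ?m k \<sigma> j * z j) = (\<Sum>j = 1..d. \<sigma> j * int (k j) * z j)" for k \<sigma>
    by (intro sum.cong) auto
  have "nonzero_mod d n (mirrored d \<Lambda>) z \<longleftrightarrow>
        (\<forall>k \<in> \<Lambda>. \<forall>\<sigma> \<in> {1..d} \<rightarrow>\<^sub>E {-1, 1}. ?m k \<sigma> \<noteq> zero_vec d \<longrightarrow>
           \<not> [(\<Sum>j = 1..d. ?m k \<sigma> j * z j) = 0] (mod int n))"
    unfolding nonzero_mod_def mirrored_def by blast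
  then show ?thesis
    by (simp only: dot)
qed

section \<open>Component-by-component construction\<close>

text \<open>
  If every candidate \<open>b\<close> failed, each would be ruled out by some index \<open>H b\<close> with nonzero last
  component. The indices \<open>\<plusminus> H b\<close> would then be \<open>2 (n - 1)\<close> distinct nonzero elements of \<open>B\<close>,
  because an index determines the only residue that it or its negative rules out.
\<close>

lemma cbc_step:
  fixes z :: "nat \<Rightarrow> int"
  assumes "prime n" and "s \<ge> 1"
    and ext: "B \<subseteq> {1..s} \<rightarrow>\<^sub>E UNIV" and fin: "finite B"
    and sym: "\<And>h. h \<in> B \<Longrightarrow> (\<lambda>j\<in>{1..s}. - h j) \<in> B"
    and bound: "\<And>h. h \<in> B \<Longrightarrow> \<bar>h s\<bar> < int n"
    and few: "card (B - {zero_vec s}) < 2 * (n - 1)"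
    and drop: "\<And>h. h \<in> B \<Longrightarrow> h s = 0 \<Longrightarrow> restrict h {1..s-1} \<in> B'"
    and prev: "nonzero_mod (s - 1) n B' z"
  shows "\<exists>b \<in> {1..int n - 1}. nonzero_mod s n B (z(s := b))"
proof (rule ccontr)
  assume contra: "\<not> ?thesis"
  define D where "D h = (\<Sum>j = 1..s-1. h j * z j)" for h
  have split: "(\<Sum>j = 1..s. h j * (z(s := b)) j) = D h + h s * b" for h b
  proof -
    obtain t where t: "s = Suc t"
      using assms(2) by (cases s) auto
    show ?thesis
      unfolding t D_def by simp
  qed
  have "\<forall>b \<in> {1..int n - 1}. \<exists>h. h \<in> B \<and> h \<noteq> zero_vec s \<and> int n dvd D h + h s * b"
    using contra unfolding nonzero_mod_def split cong_0_iff by auto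
  then obtain H where H: "\<And>b. b \<in> {1..int n - 1} \<Longrightarrow> H b \<in> B"
      "\<And>b. b \<in> {1..int n - 1} \<Longrightarrow> H b \<noteq> zero_vec s"
      "\<And>b. b \<in> {1..int n - 1} \<Longrightarrow> int n dvd D (H b) + H b s * b"
    by metis
  have last: "H b s \<noteq> 0" if b: "b \<in> {1..int n - 1}" for b
  proof
    assume 0: "H b s = 0"
    have "restrict (H b) {1..s-1} \<noteq> zero_vec (s - 1)"
    proof
      assume eq: "restrict (H b) {1..s-1} = zero_vec (s - 1)"
      have "H b = zero_vec s"
      proof
        fix j
        show "H b j = zero_vec s j"
        proof (cases "j \<in> {1..s-1}")
          case True
          then show ?thesis
            using fun_cong[OF eq, of j] by (auto simp: zero_vec_def)
        next
          case False
          have "H b j = undefined" if "j \<notin> {1..s}"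
            using PiE_arb[OF subsetD[OF ext H(1)[OF b]] that] .
          moreover have "j = s" if "j \<in> {1..s}"
            using False that by auto
          ultimately show ?thesis
            using 0 by (auto simp: zero_vec_def)
        qed
      qed
      then show False using H(2)[OF b] by simp
    qed
    then have "\<not> int n dvd (\<Sum>j = 1..s-1. restrict (H b) {1..s-1} j * z j)"
      using prev drop[OF H(1)[OF b] 0] unfolding nonzero_mod_def cong_0_iff by blast
    moreover have "(\<Sum>j = 1..s-1. restrict (H b) {1..s-1} j * z j) = D (H b)"
      unfolding D_def by (intro sum.cong) auto
    ultimately have "\<not> int n dvd D (H b)"
      by metis
    then show False using H(3)[OF b] 0 by simp
  qed
  let ?X = "{-1, 1::int} \<times> {1..int n - 1}"
  let ?F = "\<lambda>(e, b). \<lambda>j\<in>{1..s}. e * H b j"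
  have sub: "?F ` ?X \<subseteq> B - {zero_vec s}"
  proof (rule image_subsetI)
    fix p assume "p \<in> ?X"
    then obtain e b where p: "p = (e, b)" and e: "e = -1 \<or> e = 1" and b: "b \<in> {1..int n - 1}"
      by auto
    have "restrict (H b) {1..s} = H b"
      using H(1)[OF b] ext by (auto intro: PiE_restrict)
    then have "?F p \<in> B"
      using e sym[OF H(1)[OF b]] H(1)[OF b] by (auto simp: p)
    moreover have "?F p s \<noteq> zero_vec s s"
      using e last[OF b] assms(2) by (auto simp: p zero_vec_def)
    ultimately show "?F p \<in> B - {zero_vec s}"
      by (metis DiffI singletonD)
  qed
  have "inj_on ?F ?X"
  proof (rule inj_onI)
    fix p q assume "p \<in> ?X" "q \<in> ?X" and eq: "?F p = ?F q"
    then obtain e b e' b' where p: "p = (e, b)" and q: "q = (e', b')"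
      and e: "e = -1 \<or> e = 1" and b: "b \<in> {1..int n - 1}" and b': "b' \<in> {1..int n - 1}"
      by auto
    have comp: "e * H b j = e' * H b' j" if "j \<in> {1..s}" for j
      using fun_cong[OF eq, of j] that by (simp add: p q)
    have D: "e * D (H b) = e' * D (H b')"
      unfolding D_def sum_distrib_left mult.assoc[symmetric]
      by (intro sum.cong refl arg_cong2[where f="(*)"] comp) auto
    have s: "e * H b s = e' * H b' s"
      using comp assms(2) by simp
    \<comment> \<open>The signed indices agree, so subtracting the two congruences eliminates the first \<open>s - 1\<close>
      components and leaves a multiple of \<open>b - b'\<close> by a unit modulo \<open>n\<close>.\<close>
    have "e * (D (H b) + H b s * b) - e' * (D (H b') + H b' s * b') =
        (e * D (H b) - e' * D (H b')) + ((e * H b s) * b - (e' * H b' s) * b')"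
      by (simp add: algebra_simps)
    also have "\<dots> = e * H b s * (b - b')"
      unfolding D s[symmetric] by (simp add: right_diff_distrib)
    finally have "int n dvd e * H b s * (b - b')"
      using H(3)[OF b] H(3)[OF b'] by (metis dvd_diff dvd_mult)
    then have "int n dvd H b s * (b - b')"
      using e by auto
    then have "int n dvd H b s \<or> int n dvd b - b'"
      using assms(1) by (intro prime_dvd_multD) simp_all
    moreover have "\<not> int n dvd H b s"
      using last[OF b] bound[OF H(1)[OF b]] dvd_imp_le_int[of "H b s" "int n"] by auto
    ultimately have "int n dvd b - b'" by simp
    then have "b = b'"
      using b b' dvd_imp_le_int[of "b - b'" "int n"] by (cases "b - b' = 0") auto
    moreover from this have "e = e'"
      using s last[OF b] by simp
    ultimately show "p = q" by (simp add: p q)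
  qed
  then have "card ?X \<le> card (B - {zero_vec s})"
    using sub fin by (intro card_inj_on_le[of ?F]) auto
  moreover have "card ?X = 2 * (n - 1)"
    by (simp add: card_cartesian_product nat_diff_distrib)
  ultimately show False using few by simp
qed

text \<open>
  What the construction uses of a family of projections. Negation symmetry holds for index sets
  of the form \<open>mirrored d \<Lambda>\<close> and passes to both kinds of projection.
\<close>

lemma cbc_constructible_of_symmetric_projections:
  assumes "prime n"
    and P_d: "P d = A"
    and ext: "\<And>s. s \<le> d \<Longrightarrow> P s \<subseteq> {1..s} \<rightarrow>\<^sub>E UNIV"
    and fin: "\<And>s. s \<le> d \<Longrightarrow> finite (P s)"
    and sym: "\<And>s h. s \<le> d \<Longrightarrow> h \<in> P s \<Longrightarrow> (\<lambda>j\<in>{1..s}. - h j) \<in> P s"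
    and bound: "\<And>s h j. s \<le> d \<Longrightarrow> h \<in> P s \<Longrightarrow> j \<in> {1..s} \<Longrightarrow> \<bar>h j\<bar> < int n"
    and few: "\<And>s. s \<le> d \<Longrightarrow> card (P s - {zero_vec s}) < 2 * (n - 1)"
    and drop: "\<And>s h. 1 \<le> s \<Longrightarrow> s \<le> d \<Longrightarrow> h \<in> P s \<Longrightarrow> h s = 0 \<Longrightarrow> restrict h {1..s-1} \<in> P (s - 1)"
    and "d \<ge> 1"
  shows "cbc_constructible d n A P"
proof -
  have step: "\<exists>b \<in> {1..int n - 1}. nonzero_mod s n (P s) (z(s := b))"
    if "s \<in> {1..d}" "nonzero_mod (s - 1) n (P (s - 1)) z" for s z
    by (rule cbc_step[OF assms(1), where B' = "P (s - 1)"])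
       (use that ext fin sym bound few drop in auto)
  have final: "nonzero_mod d n A z"
    if "z \<in> {1..d} \<rightarrow>\<^sub>E {1..int n - 1}" "\<forall>s \<in> {1..d}. nonzero_mod s n (P s) (restrict z {1..s})" for z
    using that \<open>d \<ge> 1\<close> P_d by (metis PiE_restrict atLeastAtMost_iff order_refl)
  have "\<exists>z \<in> {1..t} \<rightarrow>\<^sub>E {1..int n - 1}. \<forall>s \<in> {1..t}. nonzero_mod s n (P s) (restrict z {1..s})"
    if "t \<le> d" for t
    using that
  proof (induction t)
    case 0
    then show ?case by auto
  next
    case (Suc t)
    then obtain z where z: "z \<in> {1..t} \<rightarrow>\<^sub>E {1..int n - 1}"
      and ok: "\<forall>s\<in>{1..t}. nonzero_mod s n (P s) (restrict z {1..s})"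
      by (meson Suc_leD)
    have "nonzero_mod t n (P t) z"
    proof (cases "t = 0")
      case True
      \<comment> \<open>In dimension \<open>0\<close> the only vector is the zero vector, so the condition is void.\<close>
      have "P 0 \<subseteq> {zero_vec 0}"
        using ext[of 0] by (simp add: zero_vec_def restrict_def)
      then show ?thesis using True by (auto simp: nonzero_mod_def)
    next
      case False
      then show ?thesis using bspec[OF ok, of t] PiE_restrict[OF z] by simp
    qed
    then obtain b where b: "b \<in> {1..int n - 1}" "nonzero_mod (Suc t) n (P (Suc t)) (z(Suc t := b))"
      using step[of "Suc t" z] Suc.prems by auto
    let ?z = "z(Suc t := b)"
    have mem: "?z \<in> {1..Suc t} \<rightarrow>\<^sub>E {1..int n - 1}"
      using z b(1) by (auto simp: PiE_iff extensional_def)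
    have "nonzero_mod s n (P s) (restrict ?z {1..s})" if "s \<in> {1..Suc t}" for s
    proof (cases "s = Suc t")
      case True
      then show ?thesis using b(2) PiE_restrict[OF mem] by simp
    next
      case False
      then have "restrict ?z {1..s} = restrict z {1..s}"
        using that by (auto simp: restrict_def fun_eq_iff)
      then show ?thesis using bspec[OF ok, of s] False that by simp
    qed
    then show ?case using mem by blast
  qed
  from this[of d] show ?thesis
    unfolding cbc_constructible_def using step final by auto
qed

section \<open>Projections of the mirrored index set\<close>

lemma merge_zero_drop:
  fixes s d :: nat and h :: "nat \<Rightarrow> int"
  assumes "1 \<le> s" and "s \<le> d" and "h s = 0"
  shows "merge {1..s-1} {s-1+1..d} (restrict h {1..s-1}, \<lambda>j\<in>{s-1+1..d}. 0) =
         merge {1..s} {s+1..d} (h, \<lambda>j\<in>{s+1..d}. 0)"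
proof
  fix j
  show "merge {1..s-1} {s-1+1..d} (restrict h {1..s-1}, \<lambda>j\<in>{s-1+1..d}. 0) j =
        merge {1..s} {s+1..d} (h, \<lambda>j\<in>{s+1..d}. 0) j"
    using assms by (cases "j = s") (auto simp: merge_def)
qed

lemma full_projection_eq_image:
  assumes "A \<subseteq> {1..d} \<rightarrow>\<^sub>E UNIV" and "s \<le> d"
  shows "full_projection d A s = (\<lambda>a. restrict a {1..s}) ` A"
proof (intro equalityI subsetI)
  fix h assume "h \<in> full_projection d A s"
  then obtain h' where h: "h \<in> {1..s} \<rightarrow>\<^sub>E UNIV" and a: "merge {1..s} {s+1..d} (h, h') \<in> A"
    by (auto simp: full_projection_def)
  have "h = restrict (merge {1..s} {s+1..d} (h, h')) {1..s}"
    using h by (auto simp: merge_def fun_eq_iff PiE_iff extensional_def)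
  then show "h \<in> (\<lambda>a. restrict a {1..s}) ` A"
    using a by blast
next
  fix h assume "h \<in> (\<lambda>a. restrict a {1..s}) ` A"
  then obtain a where a: "a \<in> A" and h: "h = restrict a {1..s}"
    by auto
  have "merge {1..s} {s+1..d} (h, restrict a {s+1..d}) = a"
    using a assms by (auto simp: h merge_def fun_eq_iff PiE_iff extensional_def)
  then show "h \<in> full_projection d A s"
    using a unfolding full_projection_def
    by (auto simp: h intro!: bexI[of _ "restrict a {s+1..d}"])
qed

lemma zero_section_subset_full_projection: "zero_section d A s \<subseteq> full_projection d A s"
  unfolding zero_section_def full_projection_def
  by (intro Collect_mono conj_mono imp_refl impI bexI[where x = "\<lambda>j\<in>{s+1..d}. 0"]) auto

lemma zero_section_self:
  assumes "A \<subseteq> {1..d} \<rightarrow>\<^sub>E UNIV"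
  shows "zero_section d A d = A"
proof -
  have "merge {1..d} {d+1..d} (h, h') = h" if "h \<in> {1..d} \<rightarrow>\<^sub>E UNIV" for h h' :: "nat \<Rightarrow> int"
    using that by (auto simp: merge_def fun_eq_iff PiE_iff extensional_def)
  then show ?thesis
    using assms by (auto simp: zero_section_def)
qed

text \<open>
  Both families of projections inherit finiteness, size and the bound on the entries from \<open>A\<close>
  because \<open>P s\<close> consists of restrictions of elements of \<open>A\<close>, and only a nonzero element
  restricts to a nonzero vector.
\<close>

lemma cbc_constructible_of_restrictions:
  assumes "prime n" and "d \<ge> 1"
    and A: "A \<subseteq> {1..d} \<rightarrow>\<^sub>E UNIV" "finite A"
    and few: "card (A - {zero_vec d}) < 2 * (n - 1)"
    and bound: "\<And>h j. h \<in> A \<Longrightarrow> j \<in> {1..d} \<Longrightarrow> \<bar>h j\<bar> < int n"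
    and P_d: "P d = A"
    and sub: "\<And>s. s \<le> d \<Longrightarrow> P s \<subseteq> (\<lambda>a. restrict a {1..s}) ` A"
    and sym: "\<And>s h. s \<le> d \<Longrightarrow> h \<in> P s \<Longrightarrow> (\<lambda>j\<in>{1..s}. - h j) \<in> P s"
    and drop: "\<And>s h. 1 \<le> s \<Longrightarrow> s \<le> d \<Longrightarrow> h \<in> P s \<Longrightarrow> h s = 0 \<Longrightarrow> restrict h {1..s-1} \<in> P (s - 1)"
  shows "cbc_constructible d n A P"
proof (rule cbc_constructible_of_symmetric_projections[OF assms(1) P_d _ _ sym _ _ drop assms(2)])
  fix s assume s: "s \<le> d"
  show "P s \<subseteq> {1..s} \<rightarrow>\<^sub>E UNIV"
    using sub[OF s] by auto
  show "finite (P s)"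
    using sub[OF s] A(2) finite_surj by blast
  show "\<bar>h j\<bar> < int n" if "h \<in> P s" "j \<in> {1..s}" for h j
    using that sub[OF s] s bound by fastforce
  have "restrict (zero_vec d) {1..s} = zero_vec s"
    using s by (auto simp: zero_vec_def restrict_def fun_eq_iff)
  then have "P s - {zero_vec s} \<subseteq> (\<lambda>a. restrict a {1..s}) ` (A - {zero_vec d})"
    using sub[OF s] by blast
  then have "card (P s - {zero_vec s}) \<le> card (A - {zero_vec d})"
    using A(2) by (intro surj_card_le) auto
  then show "card (P s - {zero_vec s}) < 2 * (n - 1)"
    using few by simp
qed auto

lemma mirrored_extensional: "mirrored d \<Lambda> \<subseteq> {1..d} \<rightarrow>\<^sub>E UNIV"
  by (auto simp: mirrored_def)

lemma finite_mirrored: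
  assumes "finite \<Lambda>"
  shows "finite (mirrored d \<Lambda>)"
proof -
  have "mirrored d \<Lambda> \<subseteq> (\<lambda>(k, \<sigma>). \<lambda>j\<in>{1..d}. \<sigma> j * int (k j)) ` (\<Lambda> \<times> ({1..d} \<rightarrow>\<^sub>E {-1, 1}))"
    by (auto simp: mirrored_def)
  then show ?thesis
    by (rule finite_subset) (use assms in \<open>auto intro!: finite_PiE\<close>)
qed

lemma mirrored_uminus:
  assumes "h \<in> mirrored d \<Lambda>"
  shows "(\<lambda>j\<in>{1..d}. - h j) \<in> mirrored d \<Lambda>"
proof -
  obtain k \<sigma> where k: "k \<in> \<Lambda>" and \<sigma>: "\<sigma> \<in> {1..d} \<rightarrow>\<^sub>E {-1, 1}"
    and h: "h = (\<lambda>j\<in>{1..d}. \<sigma> j * int (k j))"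
    using assms by (auto simp: mirrored_def)
  have "(\<lambda>j\<in>{1..d}. - \<sigma> j) \<in> {1..d} \<rightarrow>\<^sub>E {-1, 1}"
    using \<sigma> by (fastforce simp: PiE_iff)
  moreover have "(\<lambda>j\<in>{1..d}. - h j) = (\<lambda>j\<in>{1..d}. (\<lambda>j\<in>{1..d}. - \<sigma> j) j * int (k j))"
    by (auto simp: h restrict_def fun_eq_iff)
  ultimately show ?thesis
    using k unfolding mirrored_def by blast
qed

lemma mirrored_entry_le_max_index:
  assumes "finite \<Lambda>" and "h \<in> mirrored d \<Lambda>" and "j \<in> {1..d}"
  shows "\<bar>h j\<bar> \<le> int (max_index d \<Lambda>)"
proof -
  obtain k \<sigma> where k: "k \<in> \<Lambda>" and \<sigma>: "\<sigma> \<in> {1..d} \<rightarrow>\<^sub>E {-1, 1}"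
    and h: "h = (\<lambda>j\<in>{1..d}. \<sigma> j * int (k j))"
    using assms(2) by (auto simp: mirrored_def)
  have "finite {k j | k j. k \<in> \<Lambda> \<and> j \<in> {1..d}}"
    by (rule finite_image_set2[of "\<lambda>k. k \<in> \<Lambda>" "\<lambda>j. j \<in> {1..d}" "\<lambda>k j. k j"])
       (use assms(1) in auto)
  then have "k j \<le> max_index d \<Lambda>"
    unfolding max_index_def by (intro Max_ge) (use k assms(3) in auto)
  moreover have "\<bar>h j\<bar> = int (k j)"
    using PiE_mem[OF \<sigma> assms(3)] assms(3) by (auto simp: h)
  ultimately show ?thesis by simp
qed

lemma cbc_constructible_mirrored:
  assumes "prime n" and "d \<ge> 1" and "finite \<Lambda>"
    and few: "card (mirrored d \<Lambda> - {zero_vec d}) < 2 * (n - 1)"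
    and large: "max_index d \<Lambda> < n"
  shows "cbc_constructible d n (mirrored d \<Lambda>) (zero_section d (mirrored d \<Lambda>))"
    and "cbc_constructible d n (mirrored d \<Lambda>) (full_projection d (mirrored d \<Lambda>))"
proof -
  let ?A = "mirrored d \<Lambda>"
  note A = mirrored_extensional[of d \<Lambda>]
  note fp = full_projection_eq_image[OF A]
  have bound: "\<bar>h j\<bar> < int n" if "h \<in> ?A" "j \<in> {1..d}" for h j
    using mirrored_entry_le_max_index[OF assms(3) that] large by linarith
  show "cbc_constructible d n ?A (zero_section d ?A)"
  proof (rule cbc_constructible_of_restrictions[where A = ?A and P = "zero_section d ?A", OF assms(1,2) A finite_mirrored[OF assms(3)] few _
          zero_section_self[OF A]])
    fix h j assume "h \<in> ?A" "j \<in> {1..d}"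
    then show "\<bar>h j\<bar> < int n"
      by (rule bound)
  next
    fix s assume "s \<le> d"
    then show "zero_section d ?A s \<subseteq> (\<lambda>a. restrict a {1..s}) ` ?A"
      using zero_section_subset_full_projection fp by blast
  next
    fix s h assume s: "s \<le> d" and h: "h \<in> zero_section d ?A s"
    let ?m = "\<lambda>h. merge {1..s} {s+1..d} (h, \<lambda>j\<in>{s+1..d}. 0::int)"
    have "?m (\<lambda>j\<in>{1..s}. - h j) = (\<lambda>j\<in>{1..d}. - ?m h j)"
      using s by (auto simp: merge_def fun_eq_iff)
    then show "(\<lambda>j\<in>{1..s}. - h j) \<in> zero_section d ?A s"
      using mirrored_uminus[of "?m h" d \<Lambda>] h by (auto simp: zero_section_def)
  next
    fix s h assume "1 \<le> s" "s \<le> d" and h: "h \<in> zero_section d ?A s" and "h s = 0"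
    then have "merge {1..s-1} {s-1+1..d} (restrict h {1..s-1}, \<lambda>j\<in>{s-1+1..d}. 0) \<in> ?A"
      by (subst merge_zero_drop) (auto simp: zero_section_def)
    then show "restrict h {1..s-1} \<in> zero_section d ?A (s - 1)"
      unfolding zero_section_def by auto
  qed
  show "cbc_constructible d n ?A (full_projection d ?A)"
  proof (rule cbc_constructible_of_restrictions[where A = ?A and P = "full_projection d ?A", OF assms(1,2) A finite_mirrored[OF assms(3)] few])
    fix h j assume "h \<in> ?A" "j \<in> {1..d}"
    then show "\<bar>h j\<bar> < int n"
      by (rule bound)
  next
    show "full_projection d ?A d = ?A"
      unfolding fp[OF order_refl] using A by (force simp: PiE_restrict)
  next
    fix s assume "s \<le> d"
    then show "full_projection d ?A s \<subseteq> (\<lambda>a. restrict a {1..s}) ` ?A"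
      using fp by blast
  next
    fix s h assume s: "s \<le> d" and h: "h \<in> full_projection d ?A s"
    then obtain a where a: "a \<in> ?A" and h: "h = restrict a {1..s}"
      using fp by auto
    have "(\<lambda>j\<in>{1..s}. - h j) = restrict (\<lambda>j\<in>{1..d}. - a j) {1..s}"
      using s by (auto simp: h restrict_def fun_eq_iff)
    then show "(\<lambda>j\<in>{1..s}. - h j) \<in> full_projection d ?A s"
      unfolding fp[OF s] using mirrored_uminus[OF a] by blast
  next
    fix s h assume s: "1 \<le> s" "s \<le> d" and h: "h \<in> full_projection d ?A s"
    then obtain a where a: "a \<in> ?A" and h: "h = restrict a {1..s}"
      using fp by auto
    have "restrict h {1..s-1} = restrict a {1..s-1}"
      by (auto simp: h restrict_def fun_eq_iff)
    then show "restrict h {1..s-1} \<in> full_projection d ?A (s - 1)"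
      using s a by (subst fp) auto
  qed
qed

section \<open>Exactness criterion and existence of generating vectors\<close>

theorem lemma10:
  fixes d n :: nat and \<Lambda> :: "(nat \<Rightarrow> nat) set"
  assumes "d \<ge> 1" and "n \<ge> 1"
    and "finite \<Lambda>" and "\<Lambda> \<subseteq> {1..d} \<rightarrow>\<^sub>E UNIV"
  shows "(\<forall>z \<in> {1..d} \<rightarrow>\<^sub>E (UNIV :: int set).
            (\<forall>f \<in> cosine_space d \<Lambda>. tent_lattice_rule d n z f = cube_integral d f)
            \<longleftrightarrow> nonzero_mod d n (mirrored d \<Lambda>) z) \<and>
         (prime n \<and>
          real n > max (real (card (mirrored d \<Lambda> - {zero_vec d})) / 2 + 1)
                       (real (max_index d \<Lambda>)) \<longrightarrow>
            cbc_constructible d n (mirrored d \<Lambda>) (zero_section d (mirrored d \<Lambda>)) \<and>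
            cbc_constructible d n (mirrored d \<Lambda>) (full_projection d (mirrored d \<Lambda>)))"
proof (intro conjI impI ballI)
  fix z :: "nat \<Rightarrow> int"
  show "(\<forall>f \<in> cosine_space d \<Lambda>. tent_lattice_rule d n z f = cube_integral d f)
        \<longleftrightarrow> nonzero_mod d n (mirrored d \<Lambda>) z"
    unfolding exact_on_cosine_space_iff_exact_on_basis[OF assms(2,3)]
      exact_on_cos_basis_iff[OF assms(2)] nonzero_mod_mirrored_iff ..
next
  assume *: "prime n \<and> real n > max (real (card (mirrored d \<Lambda> - {zero_vec d})) / 2 + 1)
                       (real (max_index d \<Lambda>))"
  then have few: "card (mirrored d \<Lambda> - {zero_vec d}) < 2 * (n - 1)" and large: "max_index d \<Lambda> < n"
    by linarith+
  show "cbc_constructible d n (mirrored d \<Lambda>) (zero_section d (mirrored d \<Lambda>))"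
    and "cbc_constructible d n (mirrored d \<Lambda>) (full_projection d (mirrored d \<Lambda>))"
    using cbc_constructible_mirrored[OF _ assms(1,3) few large] * by blast+
qed

end
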